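(* Let $q$ be a prime power, $p=\operatorname{char}\mathbb F_q$, and $n\ge1$. Let $\mathfrak M(q,n)$ be the number of equivalence classes of polynomials of degree $n$ in $\mathbb F_q[X]$, where $f,g\in\mathbb F_q[X]\setminus\mathbb F_q$ are equivalent if $g=\alpha\circ f\circ\beta$ for some $\alpha,\beta\in\mathrm{AGL}(1,\mathbb F_q)$. Then \[ \mathfrak M(q,n)=\frac{q^{n-2}}{q-1}+\frac 1{q-1}\sum_{1<d\,\mid\, q-1}\phi(d)q^{\lceil n/d\rceil-1}+\begin{cases} q^{n/p-1}&\text{if } p\mid n,\\ q^{-1}&\text{if } n=1,\\ 0&\text{if } p\nmid n \text{ and } n>1, \end{cases} \] where $\phi$ is Euler's totient function.
   Context: $\mathrm{AGL}(1,\mathbb F_q)=\{aX+b: a\in\mathbb F_q^*,\ b\in\mathbb F_q\}$, a group under composition. *)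

theory Defs
  imports
    "HOL-Computational_Algebra.Computational_Algebra"
    "HOL-Number_Theory.Totient"
    "HOL-Library.Cardinality"
begin

text \<open>The finite field with \<open>q\<close> elements is any type \<open>'a :: {field, finite}\<close>, with
  \<open>q = CARD('a)\<close>.  Recall that \<open>[:b, a:]\<close> is the polynomial \<open>a X + b\<close>.\<close>

definition AGL1 :: "'a :: field poly set" where
  "AGL1 = {[:b, a:] | a b. a \<noteq> 0}"

definition nonconst_polys :: "'a :: field poly set" where
  "nonconst_polys = UNIV - range (\<lambda>c. [:c:])"

definition affine_equiv :: "('a :: field poly \<times> 'a poly) set" where
  "affine_equiv = {(f, g). f \<in> nonconst_polys \<and> g \<in> nonconst_polys \<and>
     (\<exists>\<alpha>\<in>AGL1. \<exists>\<beta>\<in>AGL1. g = \<alpha> \<circ>\<^sub>p f \<circ>\<^sub>p \<beta>)}"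

text \<open>The number \<open>\<MM>(q, n)\<close>: for \<open>n \<ge> 1\<close> equivalence preserves the degree, so the quotient
  consists of the classes of the polynomials of degree \<open>n\<close>.\<close>

definition num_classes :: "'a :: {field, finite} itself \<Rightarrow> nat \<Rightarrow> nat" where
  "num_classes _ n = card ({f :: 'a poly. degree f = n} // affine_equiv)"

lemma AGL1_id: "[:0, 1:] \<in> AGL1"
  by (auto simp: AGL1_def)

lemma AGL1_pcompose: "\<alpha> \<in> AGL1 \<Longrightarrow> \<beta> \<in> AGL1 \<Longrightarrow> \<alpha> \<circ>\<^sub>p \<beta> \<in> AGL1"
  by (auto simp: AGL1_def pcompose_pCons)

lemma AGL1_inverse:
  assumes "\<alpha> \<in> AGL1"
  obtains \<alpha>' where "\<alpha>' \<in> AGL1" "\<alpha>' \<circ>\<^sub>p \<alpha> = [:0, 1:]" "\<alpha> \<circ>\<^sub>p \<alpha>' = [:0, 1:]"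
proof -
  from assms obtain a b where ab: "\<alpha> = [:b, a:]" "a \<noteq> 0"
    by (auto simp: AGL1_def)
  show ?thesis
    by (rule that[of "[:- b / a, 1 / a:]"]) (use ab in \<open>auto simp: AGL1_def pcompose_pCons\<close>)
qed

lemma equiv_affine_equiv: "equiv (nonconst_polys :: 'a :: field poly set) affine_equiv"
  (is "equiv ?A ?R")
proof (rule equivI)
  show "?R \<subseteq> ?A \<times> ?A"
    by (auto simp: affine_equiv_def)
  show "refl_on ?A ?R"
    unfolding refl_on_def affine_equiv_def
    by (auto intro!: bexI[OF _ AGL1_id] simp: pcompose_pCons)
  show "sym ?R"
  proof (rule symI)
    fix f g :: "'a poly" assume "(f, g) \<in> affine_equiv"
    then obtain \<alpha> \<beta> where *: "f \<in> nonconst_polys" "g \<in> nonconst_polys"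
      "\<alpha> \<in> AGL1" "\<beta> \<in> AGL1" "g = \<alpha> \<circ>\<^sub>p f \<circ>\<^sub>p \<beta>"
      by (auto simp: affine_equiv_def)
    obtain \<alpha>' where a: "\<alpha>' \<in> AGL1" "\<alpha>' \<circ>\<^sub>p \<alpha> = [:0, 1:]" by (rule AGL1_inverse[OF *(3)])
    obtain \<beta>' where b: "\<beta>' \<in> AGL1" "\<beta> \<circ>\<^sub>p \<beta>' = [:0, 1:]" by (rule AGL1_inverse[OF *(4)])
    have "\<alpha>' \<circ>\<^sub>p g \<circ>\<^sub>p \<beta>' = (\<alpha>' \<circ>\<^sub>p \<alpha>) \<circ>\<^sub>p f \<circ>\<^sub>p (\<beta> \<circ>\<^sub>p \<beta>')"
      by (simp add: *(5) pcompose_assoc)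
    also have "\<dots> = f" using a b by (simp add: pcompose_pCons)
    finally have "f = \<alpha>' \<circ>\<^sub>p g \<circ>\<^sub>p \<beta>'" ..
    with *(1,2) a(1) b(1) show "(g, f) \<in> affine_equiv"
      unfolding affine_equiv_def by blast
  qed
  show "trans ?R"
  proof (rule transI)
    fix f g h :: "'a poly" assume "(f, g) \<in> affine_equiv" "(g, h) \<in> affine_equiv"
    then obtain \<alpha> \<beta> \<alpha>' \<beta>' where *: "f \<in> nonconst_polys" "h \<in> nonconst_polys"
      "\<alpha> \<in> AGL1" "\<beta> \<in> AGL1" "\<alpha>' \<in> AGL1" "\<beta>' \<in> AGL1"
      "h = \<alpha>' \<circ>\<^sub>p (\<alpha> \<circ>\<^sub>p f \<circ>\<^sub>p \<beta>) \<circ>\<^sub>p \<beta>'"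
      by (auto simp: affine_equiv_def)
    have "h = (\<alpha>' \<circ>\<^sub>p \<alpha>) \<circ>\<^sub>p f \<circ>\<^sub>p (\<beta> \<circ>\<^sub>p \<beta>')" by (simp add: *(7) pcompose_assoc)
    with * show "(f, h) \<in> affine_equiv"
      unfolding affine_equiv_def using AGL1_pcompose by blast
  qed
qed

end

theory Submission
  imports "HOL-Algebra.Multiplicative_Group" Defs
begin

text \<open>
  Every class of degree \<open>n\<close> meets the set of monic polynomials of degree \<open>n\<close> without constant term,
  on which \<open>AGL(1, q)\<close> acts by \<open>f \<mapsto> f \<circ> \<beta>\<close> followed by the unique renormalization on the left, so
  Burnside's lemma applies. The identity fixes all \<open>q ^ (n - 1)\<close> polynomials. A map \<open>a X + b\<close>,
  \<open>a \<noteq> 1\<close>, is conjugate to \<open>a X\<close>, which fixes those polynomials whose exponents are all congruent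
  to \<open>n\<close> modulo the order of \<open>a\<close>. A translation \<open>X + b\<close> fixes exactly the polynomials
  \<open>e X + g(X ^ p - b ^ (p - 1) X)\<close>.
\<close>

subsection \<open>The multiplicative group of a finite field\<close>

lemma card_field_ge_2: "CARD('a :: {field, finite}) \<ge> 2"
proof -
  have "card {0 :: 'a, 1} \<le> CARD('a)"
    by (intro card_mono) auto
  thus ?thesis
    by simp
qed

text \<open>Cyclicity comes from the record-based theory of fields, so the type is repackaged as the
  record \<open>R\<close>. Exponents run over \<open>{0<..N}\<close> with
  \<open>N = CARD('a) - 1\<close>, so that 1 appears as \<open>g ^ N\<close>; this is the range over
  which the totient counts numbers with a given gcd.\<close>

lemma finite_field_generator:
  obtains g :: "'a :: {field, finite}"
  where "bij_betw (\<lambda>j. g ^ j) {0<..CARD('a) - 1} (UNIV - {0})"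
    and "\<And>i. g ^ i = 1 \<longleftrightarrow> CARD('a) - 1 dvd i"
proof -
  define R :: "'a ring" where "R = \<lparr>carrier = UNIV, monoid.mult = (*), one = 1, zero = 0, add = (+)\<rparr>"
  have "\<exists>y. x + y = 0" for x :: 'a
    using add.right_inverse by blast
  moreover have "x \<noteq> 0 \<Longrightarrow> \<exists>y. x * y = 1" for x :: 'a
    by (rule exI[of _ "inverse x"]) auto
  ultimately have fld: "Ring.field R"
    unfolding R_def using add.right_inverse
    by unfold_locales (auto simp: algebra_simps Units_def)
  have pow: "x [^]\<^bsub>R\<^esub> i = x ^ i" for x and i :: nat
    by (induction i) (auto simp: nat_pow_def R_def)
  obtain g where "carrier (mult_of R) = {g [^]\<^bsub>R\<^esub> i | i::nat. i \<in> UNIV}" "g \<in> carrier (mult_of R)"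
    proof -
    have "finite (carrier R)"
      by (simp add: R_def)
    thus ?thesis
      using field.finite_field_mult_group_has_gen[OF fld] that by blast
  qed
  hence gen: "UNIV - {0} = range (\<lambda>i. g ^ i)" and g0: "g \<noteq> 0"
    unfolding pow by (auto simp: R_def)
  define N where "N = CARD('a) - 1"
  have cardN: "card (UNIV - {0 :: 'a}) = N"
    by (simp add: N_def card_Diff_singleton)
  have N_pos: "N > 0"
    using card_field_ge_2[where 'a = 'a] by (simp add: N_def)
  \<comment> \<open>Multiplication by \<open>g\<close> permutes the nonzero elements, so it leaves
    their product unchanged; cancelling the product gives \<open>g ^ N = 1\<close>.\<close>
  have "g ^ N * \<Prod>(UNIV - {0}) = (\<Prod>y\<in>UNIV-{0}. g * y)"
    by (simp add: prod.distrib cardN)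
  also have "\<dots> = \<Prod>(UNIV - {0})"
    by (rule prod.reindex_bij_witness[of _ "\<lambda>y. y / g" "\<lambda>y. g * y"]) (use g0 in auto)
  finally have gN: "g ^ N = 1"
    by simp
  have gmod: "g ^ i = g ^ (i mod N)" for i
  proof -
    have "g ^ i = g ^ (N * (i div N) + i mod N)"
      by simp
    thus ?thesis
      unfolding power_add power_mult gN by simp
  qed
  \<comment> \<open>Exponents are reduced modulo \<open>N\<close>, the residue 0 being replaced by
    \<open>N\<close>. Both sets have \<open>N\<close> elements, so surjectivity then yields
    injectivity.\<close>
  have img: "(\<lambda>j. g ^ j) ` {0<..N} = UNIV - {0}"
  proof (intro equalityI subsetI)
    fix x assume "x \<in> UNIV - {0 :: 'a}"
    then obtain i where i: "x = g ^ i"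
      unfolding gen by auto
    show "x \<in> (\<lambda>j. g ^ j) ` {0<..N}"
    proof (cases "i mod N = 0")
      case True
      hence "x = g ^ N"
        using i gmod[of i] gN by simp
      thus ?thesis
        using N_pos by auto
    next
      case False
      thus ?thesis
        using i gmod[of i] N_pos by (auto intro!: image_eqI[of _ _ "i mod N"] simp: less_imp_le)
    qed
  qed (use g0 in auto)
  have inj: "inj_on (\<lambda>j. g ^ j) {0<..N}"
    by (rule eq_card_imp_inj_on) (simp_all add: img cardN)
  have "g ^ i = 1 \<longleftrightarrow> N dvd i" for i
  proof
    assume *: "g ^ i = 1"
    show "N dvd i"
    proof (rule ccontr)
      assume "\<not> N dvd i"
      hence "i mod N \<in> {0<..N}" "N \<in> {0<..N}"
        using N_pos by (auto simp: less_imp_le mod_greater_zero_iff_not_dvd)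
      moreover have "g ^ (i mod N) = g ^ N"
        using gmod[of i] gN * by simp
      ultimately have "i mod N = N"
        using inj by (auto dest: inj_onD)
      thus False
        using N_pos mod_less_divisor[of N i] by simp
    qed
  qed (auto simp: gN power_mult elim!: dvdE)
  with img inj show ?thesis
    using that[of g] unfolding N_def[symmetric] bij_betw_def by blast
qed

text \<open>A cyclic group of order \<open>N\<close> has exactly \<open>totient d\<close> elements
  of order \<open>d\<close> for each divisor \<open>d\<close> of \<open>N\<close>, so a function of
  the order alone can be summed order by order. Leaving out 1, the only element of order 1,
  restricts the sum to \<open>d > 1\<close>.\<close>

lemma sum_by_multiplicative_order:
  fixes h :: "'a :: {field, finite} \<Rightarrow> 'b :: semiring_1"
  assumes h: "\<And>a d. a \<noteq> 0 \<Longrightarrow> d > 0 \<Longrightarrow> (\<And>i. a ^ i = 1 \<longleftrightarrow> d dvd i) \<Longrightarrow> h a = H d"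
  shows "(\<Sum>a\<in>UNIV - {0, 1}. h a) =
    (\<Sum>d | 1 < d \<and> d dvd CARD('a) - 1. of_nat (totient d) * H d)"
proof -
  define N where "N = CARD('a) - 1"
  obtain g :: 'a where bij: "bij_betw (\<lambda>j. g ^ j) {0<..N} (UNIV - {0})"
    and g1: "\<And>i. g ^ i = 1 \<longleftrightarrow> N dvd i"
    using finite_field_generator unfolding N_def by metis
  have N_pos: "N > 0"
    using card_field_ge_2[where 'a = 'a] by (simp add: N_def)
  have g0: "g \<noteq> 0"
  proof
    assume "g = 0"
    moreover have "g ^ N = 1"
      using g1[of N] by simp
    ultimately show False
      using N_pos by (simp add: power_0_left)
  qed
  have "bij_betw (\<lambda>j. g ^ j) ({0<..N} - {N}) (UNIV - {0} - {g ^ N})"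
    by (rule bij_betw_DiffI[OF bij]) (use N_pos g0 in \<open>auto simp: bij_betw_def\<close>)
  also have "{0<..N} - {N} = {0<..<N}"
    by auto
  also have "UNIV - {0} - {g ^ N} = UNIV - {0, 1}"
    using g1[of N] by auto
  finally have bij': "bij_betw (\<lambda>j. g ^ j) {0<..<N} (UNIV - {0, 1})" .
  \<comment> \<open>\<open>e j\<close> is the multiplicative order of \<open>g ^ j\<close>.\<close>
  define e where "e = (\<lambda>j. N div gcd j N)"
  have e_dvd: "e j dvd N" and e_pos: "e j > 0" for j
  proof -
    have N: "N = e j * gcd j N"
      by (simp add: e_def)
    thus "e j dvd N"
      by (rule dvdI)
    show "e j > 0"
      using N N_pos by (intro Nat.gr0I) auto
  qed
  have hg: "h (g ^ j) = H (e j)" for j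
  proof (rule h)
    fix i
    have N: "N = gcd j N * e j"
      by (simp add: e_def)
    obtain k where k: "j = gcd j N * k"
      by (meson dvdE gcd_dvd1)
    have gpos: "gcd j N > 0"
      using N_pos by simp
    \<comment> \<open>After division by \<open>gcd j N\<close> the cofactors \<open>k\<close> of
      \<open>j\<close> and \<open>e j\<close> of \<open>N\<close> are coprime, so
      \<open>N dvd j * i\<close> reduces to \<open>e j dvd i\<close>.\<close>
    have "coprime (e j) k"
    proof -
      have "gcd j N = gcd j N * gcd k (e j)"
        using k N gcd_mult_distrib_nat[of "gcd j N" k "e j"] by metis
      hence "gcd k (e j) = 1"
        using gpos by (metis mult.right_neutral mult_cancel1 less_not_refl)
      thus ?thesis
        by (simp add: coprime_iff_gcd_eq_1 gcd.commute)
    qed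
    have "(g ^ j) ^ i = 1 \<longleftrightarrow> N dvd j * i"
      using g1[of "j * i"] by (simp add: power_mult)
    also have "\<dots> \<longleftrightarrow> gcd j N * e j dvd gcd j N * (k * i)"
      using k N by (metis mult.assoc)
    also have "\<dots> \<longleftrightarrow> e j dvd k * i"
      by (rule nat_mult_dvd_cancel1[OF gpos])
    also have "\<dots> \<longleftrightarrow> e j dvd i"
      using \<open>coprime (e j) k\<close> by (simp add: coprime_dvd_mult_right_iff)
    finally show "(g ^ j) ^ i = 1 \<longleftrightarrow> e j dvd i" .
  qed (use g0 e_pos in auto)
  have crd: "card {j \<in> {0<..<N}. e j = d} = totient d" if d: "1 < d" "d dvd N" for d
  proof -
    have "{j \<in> {0<..<N}. e j = d} = {j \<in> {0<..N}. gcd j N = N div d}"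
    proof (intro equalityI subsetI)
      fix j assume "j \<in> {j \<in> {0<..<N}. e j = d}"
      moreover have "N div (N div gcd j N) = gcd j N"
        using N_pos by (intro div_div_eq_right[THEN trans]) auto
      ultimately show "j \<in> {j \<in> {0<..N}. gcd j N = N div d}"
        by (auto simp: e_def)
    next
      fix j assume j: "j \<in> {j \<in> {0<..N}. gcd j N = N div d}"
      have "N div (N div d) = d"
        using N_pos d by (intro div_div_eq_right[THEN trans]) auto
      moreover have "j \<noteq> N"
        using j d N_pos by (auto simp: div_eq_dividend_iff)
      ultimately show "j \<in> {j \<in> {0<..<N}. e j = d}"
        using j by (auto simp: e_def)
    qed
    also have "card \<dots> = totient (N div (N div d))"
      using N_pos d by (intro card_gcd_eq_totient) auto
    also have "N div (N div d) = d"
      using N_pos d by (intro div_div_eq_right[THEN trans]) auto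
    finally show ?thesis .
  qed
  have "(\<Sum>a\<in>UNIV - {0, 1}. h a) = (\<Sum>j\<in>{0<..<N}. H (e j))"
    using sum.reindex_bij_betw[OF bij', of h] by (simp add: hg)
  also have "\<dots> = (\<Sum>d | 1 < d \<and> d dvd N. \<Sum>j | j \<in> {0<..<N} \<and> e j = d. H (e j))"
  proof (rule sum.group[symmetric])
    show "e ` {0<..<N} \<subseteq> {d. 1 < d \<and> d dvd N}"
    proof safe
      fix j assume j: "j \<in> {0<..<N}"
      have "gcd j N \<le> j"
        using j by (intro gcd_le1_nat) auto
      also have "j < N"
        using j by auto
      finally have "gcd j N < N" .
      hence "e j \<noteq> 1"
        using N_pos by (metis e_def dvd_mult_div_cancel gcd_dvd2 mult.right_neutral nat_less_le)
      thus "1 < e j"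
        using e_pos[of j] by simp
    qed (use e_dvd in auto)
  qed (use N_pos in \<open>auto intro!: finite_subset[of _ "{..N}"] dest: dvd_imp_le\<close>)
  also have "\<dots> = (\<Sum>d | 1 < d \<and> d dvd N. of_nat (totient d) * H d)"
  proof (rule sum.cong)
    fix d assume d: "d \<in> {d. 1 < d \<and> d dvd N}"
    have "(\<Sum>j | j \<in> {0<..<N} \<and> e j = d. H (e j)) = (\<Sum>j | j \<in> {0<..<N} \<and> e j = d. H d)"
      by (rule sum.cong) auto
    thus "(\<Sum>j | j \<in> {0<..<N} \<and> e j = d. H (e j)) = of_nat (totient d) * H d"
      using crd[of d] d by simp
  qed auto
  finally show ?thesis
    unfolding N_def .
qed

subsection \<open>Burnside's lemma\<close>

text \<open>The elements carrying \<open>x\<close> to \<open>y\<close> form a translate of the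
  stabilizer of \<open>y\<close>, so summing the stabilizer sizes over one class gives
  \<open>card G\<close>; double counting the fixed pairs finishes. The order of the arguments of
  \<open>comp\<close> is that of a right action, as for substitution into polynomials. The relation
  \<open>R\<close> need only be the orbit relation on \<open>M\<close>, so it may live on a larger
  set \<open>A\<close>.\<close>

lemma burnside:
  fixes act :: "'g \<Rightarrow> 'x \<Rightarrow> 'x" and comp :: "'g \<Rightarrow> 'g \<Rightarrow> 'g"
  assumes fin: "finite G" "finite M"
    and R: "equiv A R" "M \<subseteq> A"
    and R_iff: "\<And>x y. x \<in> M \<Longrightarrow> y \<in> M \<Longrightarrow> (x, y) \<in> R \<longleftrightarrow> (\<exists>g\<in>G. act g x = y)"
    and act: "\<And>g x. g \<in> G \<Longrightarrow> x \<in> M \<Longrightarrow> act g x \<in> M"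
    and comp: "\<And>g h x. g \<in> G \<Longrightarrow> h \<in> G \<Longrightarrow> x \<in> M \<Longrightarrow> act h (act g x) = act (comp g h) x"
    and bij: "\<And>g. g \<in> G \<Longrightarrow> bij_betw (comp g) G G"
  shows "card (M // R) * card G = (\<Sum>g\<in>G. card {x \<in> M. act g x = x})"
proof -
  have R_class: "(x, y) \<in> R \<longleftrightarrow> R `` {x} = R `` {y}" if "x \<in> M" "y \<in> M" for x y
    using eq_equiv_class_iff[OF R(1), of x y] that R(2) by auto
  have transporter: "card {k \<in> G. act k x = y} = card {h \<in> G. act h y = y}"
    if xy: "x \<in> M" "y \<in> M" "(x, y) \<in> R" for x y
  proof -
    obtain g where g: "g \<in> G" "act g x = y"
      using R_iff xy by auto
    \<comment> \<open>First moving \<open>x\<close> to \<open>y\<close> by \<open>g\<close> and then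
      applying a stabilizing \<open>h\<close> gives precisely the elements carrying \<open>x\<close>
      to \<open>y\<close>.\<close>
    have "comp g ` {h \<in> G. act h y = y} = {k \<in> comp g ` G. act k x = y}"
      using comp[OF g(1) _ xy(1)] g(2) by auto
    hence "bij_betw (comp g) {h \<in> G. act h y = y} {k \<in> G. act k x = y}"
      using bij[OF g(1)] by (auto simp: bij_betw_def intro: inj_on_subset)
    thus ?thesis
      by (rule bij_betw_same_card[symmetric])
  qed
  \<comment> \<open>A class \<open>C\<close> of \<open>R\<close> may reach outside \<open>M\<close>,
    so the sum runs over those members of \<open>M\<close> whose class is \<open>C\<close>. The
    group is split according to the image of \<open>x\<close>.\<close>
  have fibre: "card G = (\<Sum>y | y \<in> M \<and> R `` {y} = C. card {h \<in> G. act h y = y})"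
    if "C \<in> M // R" for C
  proof -
    from that obtain x where x: "x \<in> M" "C = R `` {x}"
      by (auto elim: quotientE)
    have "card G = (\<Sum>g\<in>G. 1)"
      by simp
    also have "\<dots> = (\<Sum>y | y \<in> M \<and> R `` {y} = C. \<Sum>k | k \<in> G \<and> act k x = y. 1)"
    proof (rule sum.group[symmetric])
      show "(\<lambda>k. act k x) ` G \<subseteq> {y \<in> M. R `` {y} = C}"
      proof
        fix y assume "y \<in> (\<lambda>k. act k x) ` G"
        then obtain k where k: "k \<in> G" "y = act k x"
          by auto
        hence "y \<in> M" "(x, y) \<in> R"
          using act[OF k(1) x(1)] R_iff[OF x(1)] by auto
        thus "y \<in> {y \<in> M. R `` {y} = C}"
          using R_class x by auto
      qed
    qed (use fin in auto)
    also have "\<dots> = (\<Sum>y | y \<in> M \<and> R `` {y} = C. card {h \<in> G. act h y = y})"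
    proof (rule sum.cong)
      fix y assume "y \<in> {y \<in> M. R `` {y} = C}"
      hence "card {k \<in> G. act k x = y} = card {h \<in> G. act h y = y}"
        using x R_class by (intro transporter) auto
      thus "(\<Sum>k | k \<in> G \<and> act k x = y. 1) = card {h \<in> G. act h y = y}"
        by simp
    qed simp
    finally show ?thesis .
  qed
  have "card (M // R) * card G = (\<Sum>C\<in>M // R. card G)"
    by simp
  also have "\<dots> = (\<Sum>C\<in>M // R. \<Sum>y | y \<in> M \<and> R `` {y} = C. card {h \<in> G. act h y = y})"
    by (intro sum.cong refl fibre)
  also have "\<dots> = (\<Sum>y\<in>M. card {h \<in> G. act h y = y})"
    using fin by (intro sum.group) (auto simp: quotient_def)
  also have "\<dots> = (\<Sum>g\<in>G. card {x \<in> M. act g x = x})"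
    using fin by (intro sum_multicount_gen) auto
  finally show ?thesis .
qed

subsection \<open>Polynomials fixed by affine maps with multiplier other than 1\<close>

text \<open>The coefficients at the positions in \<open>S\<close> are free and all others are
  prescribed, so these polynomials correspond to the functions from \<open>S\<close> to the
  field.\<close>

lemma card_monic_polys_supported:
  assumes S: "S \<subseteq> {..<n}"
  shows "card {f :: 'a :: {field, finite} poly. degree f = n \<and> coeff f n = 1 \<and>
    (\<forall>i<n. i \<notin> S \<longrightarrow> coeff f i = 0)} = CARD('a) ^ card S" (is "card ?A = _")
proof -
  define F :: "(nat \<Rightarrow> 'a) \<Rightarrow> 'a poly"
    where "F = (\<lambda>u. monom 1 n + (\<Sum>i\<in>S. monom (u i) i))"
  have fin: "finite S"
    using S finite_subset by blast
  have coeff_F: "coeff (F u) i = (if i = n then 1 else if i \<in> S then u i else 0)" for u i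
    using S fin by (auto simp: F_def coeff_sum coeff_monom)
  have "bij_betw F (S \<rightarrow>\<^sub>E UNIV) ?A"
  proof (rule bij_betwI[of _ _ _ "\<lambda>f. restrict (coeff f) S"])
    show "F \<in> (S \<rightarrow>\<^sub>E UNIV) \<rightarrow> ?A"
    proof
      fix u
      have "degree (F u) \<le> n"
        using S by (intro degree_le) (auto simp: coeff_F)
      moreover have "n \<le> degree (F u)"
        by (intro le_degree) (simp add: coeff_F)
      ultimately show "F u \<in> ?A"
        by (simp add: coeff_F)
    qed
    show "restrict (coeff (F u)) S = u" if "u \<in> S \<rightarrow>\<^sub>E UNIV" for u
      using that S by (intro PiE_ext[of _ S "\<lambda>_. UNIV"]) (auto simp: coeff_F)
    show "F (restrict (coeff f) S) = f" if "f \<in> ?A" for f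
    proof (rule poly_eqI)
      fix i
      consider "i < n" | "i = n" | "i > n"
        by linarith
      thus "coeff (F (restrict (coeff f) S)) i = coeff f i"
        using that S by cases (auto simp: coeff_F coeff_eq_0)
    qed
  qed auto
  hence "card ?A = card (S \<rightarrow>\<^sub>E (UNIV :: 'a set))"
    by (rule bij_betw_same_card[symmetric])
  thus ?thesis
    using fin by (simp add: card_funcsetE)
qed

text \<open>Normal forms for left composition with affine maps: for \<open>n \<ge> 1\<close>, each
  polynomial of degree \<open>n\<close> can be brought into this set in exactly one way.\<close>

definition monic0 :: "nat \<Rightarrow> 'a :: field poly set" where
  "monic0 n = {f. degree f = n \<and> coeff f n = 1 \<and> coeff f 0 = 0}"

lemma card_monic0:
  assumes "n \<ge> 1"
  shows "card (monic0 n :: 'a :: {field, finite} poly set) = CARD('a) ^ (n - 1)"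
proof -
  have eq: "monic0 n = {f :: 'a poly. degree f = n \<and> coeff f n = 1 \<and>
      (\<forall>i<n. i \<notin> {1..<n} \<longrightarrow> coeff f i = 0)}"
    using assms by (auto simp: monic0_def not_less_eq_eq)
  have "{1..<n} \<subseteq> {..<n}"
    by auto
  thus ?thesis
    unfolding eq by (subst card_monic_polys_supported) simp_all
qed

lemma finite_monic0: "n \<ge> 1 \<Longrightarrow> finite (monic0 n :: 'a :: {field, finite} poly set)"
  by (rule card_ge_0_finite) (simp add: card_monic0)

text \<open>The polynomials fixed by \<open>a X + b\<close> modulo the left action of affine maps: comparing
  leading coefficients shows that the multiplier must be \<open>a ^ n\<close>.\<close>

definition fixed_polys :: "nat \<Rightarrow> 'a \<Rightarrow> 'a \<Rightarrow> 'a :: field poly set" where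
  "fixed_polys n a b = {f \<in> monic0 n. \<exists>c. f \<circ>\<^sub>p [:b, a:] = smult (a ^ n) f + [:c:]}"

lemma fixed_polys_id: "fixed_polys n 1 0 = monic0 n"
  by (auto simp: fixed_polys_def intro: exI[of _ 0])

text \<open>Comparing coefficients of \<open>X ^ i\<close> leaves \<open>coeff f i\<close> free when
  \<open>a ^ i = a ^ n\<close> and forces it to be 0 otherwise. With \<open>d\<close> the order of
  \<open>a\<close>, the free positions are \<open>n - d\<close>, \<open>n - 2 * d\<close>, and so
  on, as long as they are at least 1.\<close>

lemma card_fixed_polys_scaling:
  fixes a :: "'a :: {field, finite}"
  assumes n: "n \<ge> 1" and a: "a \<noteq> 0" and d: "d > 0" "\<And>i. a ^ i = 1 \<longleftrightarrow> d dvd i"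
  shows "card (fixed_polys n a 0) = CARD('a) ^ ((n - 1) div d)"
proof -
  define S where "S = {i \<in> {1..<n}. a ^ i = a ^ n}"
  have "f \<circ>\<^sub>p [:0, a:] = smult (a ^ n) f + [:c:] \<longleftrightarrow>
      c = 0 \<and> (\<forall>i<n. i \<notin> S \<longrightarrow> coeff f i = 0)" if f: "f \<in> monic0 n" for f c
  proof -
    have "f \<circ>\<^sub>p [:0, a:] = smult (a ^ n) f + [:c:] \<longleftrightarrow>
        (\<forall>i. a ^ i * coeff f i = a ^ n * coeff f i + coeff [:c:] i)"
      by (simp add: poly_eq_iff coeff_pcompose_linear)
    also have "\<dots> \<longleftrightarrow> c = 0 \<and> (\<forall>i. coeff f i = 0 \<or> a ^ i = a ^ n)"
    proof
      assume *: "\<forall>i. a ^ i * coeff f i = a ^ n * coeff f i + coeff [:c:] i"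
      from *[rule_format, of 0] have "c = 0"
        using f by (simp add: monic0_def)
      with * show "c = 0 \<and> (\<forall>i. coeff f i = 0 \<or> a ^ i = a ^ n)"
        by auto
    qed auto
    also have "(\<forall>i. coeff f i = 0 \<or> a ^ i = a ^ n) \<longleftrightarrow> (\<forall>i<n. i \<notin> S \<longrightarrow> coeff f i = 0)"
      (is "?l \<longleftrightarrow> ?r")
    proof
      assume ?r
      show ?l
      proof
        fix i
        consider "i = 0" | "1 \<le> i" "i < n" | "i = n" | "i > n"
          by linarith
        thus "coeff f i = 0 \<or> a ^ i = a ^ n"
          using \<open>?r\<close> f by cases (auto simp: S_def monic0_def coeff_eq_0)
      qed
    next
      assume ?l
      thus ?r
        using f by (auto simp: S_def monic0_def Suc_le_eq intro!: Nat.gr0I)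
    qed
    finally show ?thesis .
  qed
  hence "fixed_polys n a 0 = {f. degree f = n \<and> coeff f n = 1 \<and>
      (\<forall>i<n. i \<notin> S \<longrightarrow> coeff f i = 0)}"
    using n by (auto simp: fixed_polys_def) (auto simp: monic0_def S_def)
  moreover have "S \<subseteq> {..<n}"
    by (auto simp: S_def)
  ultimately have "card (fixed_polys n a 0) = CARD('a) ^ card S"
    by (simp add: card_monic_polys_supported)
  moreover have "card S = (n - 1) div d"
  proof -
    have pow_eq: "a ^ i = a ^ n \<longleftrightarrow> d dvd n - i" if "i < n" for i
    proof -
      have "a ^ n = a ^ i * a ^ (n - i)"
        using that by (simp flip: power_add)
      thus ?thesis
        using a d(2)[of "n - i"] by auto
    qed
    \<comment> \<open>The inequality is strict because position 0 is not free: the constant term is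
      normalized to 0. This is where \<open>n - 1\<close> enters.\<close>
    have bound: "d * k < n \<longleftrightarrow> k \<le> (n - 1) div d" for k
      using n d(1) by (auto simp: less_eq_div_iff_mult_less_eq mult.commute)
    have "bij_betw (\<lambda>k. n - d * k) {1..(n - 1) div d} S"
      unfolding bij_betw_def
    proof (intro conjI equalityI subsetI)
      show "inj_on (\<lambda>k. n - d * k) {1..(n - 1) div d}"
      proof (rule inj_onI)
        fix k l assume "k \<in> {1..(n - 1) div d}" "l \<in> {1..(n - 1) div d}" "n - d * k = n - d * l"
        moreover from this have "d * k < n" "d * l < n"
          using bound by auto
        ultimately have "d * k = d * l"
          by linarith
        thus "k = l"
          using d(1) by simp
      qed
    next
      fix i assume "i \<in> (\<lambda>k. n - d * k) ` {1..(n - 1) div d}"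
      then obtain k where k: "i = n - d * k" "k \<ge> 1" "d * k < n"
        using bound by auto
      moreover have "d * k \<ge> 1"
        using k d(1) by simp
      ultimately show "i \<in> S"
        by (auto simp: S_def pow_eq)
    next
      fix i assume i: "i \<in> S"
      hence "d dvd n - i"
        by (auto simp: S_def pow_eq)
      then obtain k where k: "n - i = d * k"
        by blast
      with i have "d * k < n" "i = n - d * k"
        by (auto simp: S_def)
      moreover have "k \<noteq> 0"
        using i k by (cases k) (auto simp: S_def)
      ultimately show "i \<in> (\<lambda>k. n - d * k) ` {1..(n - 1) div d}"
        using bound by auto
    qed
    thus ?thesis
      using bij_betw_same_card by fastforce
  qed
  ultimately show ?thesis
    by simp
qed

lemma card_fixed_polys_conj:
  fixes a b :: "'a :: {field, finite}"
  assumes n: "n \<ge> 1" and a: "a \<noteq> 1"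
  shows "card (fixed_polys n a b) = card (fixed_polys n a 0)"
proof -
  \<comment> \<open>\<open>x0\<close> is the fixed point of \<open>a X + b\<close>; translating it to \<open>0\<close> conjugates the map to \<open>a X\<close>.\<close>
  define x0 where "x0 = b / (1 - a)"
  have x0: "a * x0 + b = x0"
    using a by (simp add: x0_def field_simps)
  \<comment> \<open>Subtracting the value at \<open>x\<close> restores the vanishing constant term
    after the shift, so \<open>\<tau> x\<close> stays within \<open>monic0 n\<close>.\<close>
  define \<tau> :: "'a \<Rightarrow> 'a poly \<Rightarrow> 'a poly" where "\<tau> = (\<lambda>x f. f \<circ>\<^sub>p [:x, 1:] - [:poly f x:])"
  have monic: "\<tau> x f \<in> monic0 n" if "f \<in> monic0 n" for x f
  proof -
    have f: "degree f = n" "coeff f n = 1"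
      using that by (auto simp: monic0_def)
    have "degree (f \<circ>\<^sub>p [:x, 1:]) = n"
      using f by (simp add: degree_pcompose)
    moreover from this have "coeff (f \<circ>\<^sub>p [:x, 1:]) n = 1"
      using f lead_coeff_comp[of "[:x, 1:]" f] by simp
    ultimately have "coeff (\<tau> x f) n = 1" "degree (\<tau> x f) \<le> n"
      using n by (auto simp: \<tau>_def coeff_pCons split: nat.splits intro!: degree_diff_le)
    moreover from this have "n \<le> degree (\<tau> x f)"
      by (intro le_degree) simp
    ultimately show ?thesis
      by (simp add: monic0_def \<tau>_def)
  qed
  have inverse: "\<tau> (-x) (\<tau> x f) = f" if "f \<in> monic0 n" for x f
  proof -
    have "\<tau> (-x) (\<tau> x f) = f - [:poly f 0:]"
      by (simp add: \<tau>_def pcompose_diff poly_pcompose flip: pcompose_assoc)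
         (simp add: pcompose_pCons)
    thus ?thesis
      using that by (simp add: monic0_def poly_0_coeff_0)
  qed
  \<comment> \<open>Conjugating \<open>a X + b\<close> by the shift \<open>X + y\<close> gives
    \<open>a X + (b - y + a y)\<close>. The shift by \<open>x0\<close> makes the constant 0, and the
    shift by \<open>-x0\<close> restores \<open>b\<close>.\<close>
  have fixed: "\<tau> y f \<in> fixed_polys n a (b - y + a * y)" if *: "f \<in> fixed_polys n a b" for f y b
  proof -
    obtain c where c: "f \<circ>\<^sub>p [:b, a:] = smult (a ^ n) f + [:c:]" and f: "f \<in> monic0 n"
      using * by (auto simp: fixed_polys_def)
    have "\<tau> y f \<circ>\<^sub>p [:b - y + a * y, a:] = f \<circ>\<^sub>p [:b + a * y, a:] - [:poly f y:]"
      by (simp add: \<tau>_def pcompose_diff flip: pcompose_assoc) (simp add: pcompose_pCons)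
    also have "f \<circ>\<^sub>p [:b + a * y, a:] = f \<circ>\<^sub>p [:b, a:] \<circ>\<^sub>p [:y, 1:]"
      by (simp flip: pcompose_assoc) (simp add: pcompose_pCons algebra_simps)
    also have "\<dots> = smult (a ^ n) (f \<circ>\<^sub>p [:y, 1:]) + [:c:]"
      by (simp add: c pcompose_add pcompose_smult)
    also have "\<dots> - [:poly f y:] = smult (a ^ n) (\<tau> y f) + [:c + a ^ n * poly f y - poly f y:]"
      by (simp add: \<tau>_def smult_diff_right)
    finally show ?thesis
      using monic[OF f] by (auto simp: fixed_polys_def)
  qed
  have "bij_betw (\<tau> x0) (fixed_polys n a b) (fixed_polys n a 0)"
  proof (rule bij_betwI[of _ _ _ "\<tau> (-x0)"])
    show "\<tau> x0 \<in> fixed_polys n a b \<rightarrow> fixed_polys n a 0"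
      using fixed[of _ b x0] x0 by (auto simp: algebra_simps)
    have "0 - (-x0) + a * (-x0) = b"
      using x0 by (simp add: algebra_simps)
    thus "\<tau> (-x0) \<in> fixed_polys n a 0 \<rightarrow> fixed_polys n a b"
      using fixed[of _ 0 "-x0"] by auto
    show "\<tau> (-x0) (\<tau> x0 f) = f" if "f \<in> fixed_polys n a b" for f
      using inverse that by (auto simp: fixed_polys_def)
    show "\<tau> x0 (\<tau> (-x0) f) = f" if "f \<in> fixed_polys n a 0" for f
      using inverse[of f "-x0"] that by (auto simp: fixed_polys_def)
  qed
  thus ?thesis
    by (rule bij_betw_same_card)
qed

subsection \<open>Polynomials fixed by translations\<close>

text \<open>For \<open>b \<noteq> 0\<close> this is the product of the factors
  \<open>X - i b\<close> with \<open>i\<close> in the prime field: the monic polynomial of least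
  positive degree that is invariant under \<open>X + b\<close>.\<close>

definition translation_poly :: "'a :: field \<Rightarrow> 'a poly" where
  "translation_poly b = [:0, 1:] ^ CHAR('a) - smult (b ^ (CHAR('a) - 1)) [:0, 1:]"

lemma prime_CHAR_finite_field: "prime CHAR('a :: {field, finite})"
  using finite_imp_CHAR_pos[where 'a = 'a] prime_CHAR_semidom[where 'a = 'a] by simp

lemma monic_translation_poly:
  fixes b :: "'a :: {field, finite}"
  shows "degree (translation_poly b) = CHAR('a)" "lead_coeff (translation_poly b) = 1"
    "coeff (translation_poly b) 0 = 0"
proof -
  let ?p = "CHAR('a)"
  have p: "?p > 1"
    using prime_CHAR_finite_field prime_gt_1_nat by blast
  have eq: "translation_poly b = monom 1 ?p - monom (b ^ (?p - 1)) 1"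
    by (simp add: translation_poly_def monom_altdef smult_monom)
  have "degree (translation_poly b) \<le> ?p"
    using p unfolding eq by (intro degree_le) auto
  moreover have c: "coeff (translation_poly b) ?p = 1"
    using p unfolding eq by auto
  ultimately show deg: "degree (translation_poly b) = ?p"
    using le_degree[of "translation_poly b" ?p] by simp
  show "lead_coeff (translation_poly b) = 1"
    using c deg by simp
  show "coeff (translation_poly b) 0 = 0"
    using p unfolding eq by auto
qed

text \<open>By the Frobenius identity \<open>(X + b) ^ p = X ^ p + b ^ p\<close>, and the linear
  term contributes \<open>b ^ (p - 1) * b\<close>, which cancels the extra
  \<open>b ^ p\<close>.\<close>

lemma translation_poly_invariant:
  fixes b :: "'a :: {field, finite}"
  shows "translation_poly b \<circ>\<^sub>p [:b, 1:] = translation_poly b"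
proof -
  let ?p = "CHAR('a)"
  have p: "?p > 0"
    using prime_CHAR_finite_field prime_gt_0_nat by blast
  have "[:b, 1:] ^ ?p = ([:b:] + [:0, 1:]) ^ ?p"
    by simp
  also have "\<dots> = [:b:] ^ ?p + [:0, 1:] ^ ?p"
    by (rule freshmans_dream) (simp_all add: prime_CHAR_finite_field)
  also have "[:b:] ^ ?p = [:b ^ (?p - 1) * b:]"
    using p by (simp add: poly_const_pow flip: power_Suc2)
  finally have "[:b, 1:] ^ ?p = [:b ^ (?p - 1) * b:] + [:0, 1:] ^ ?p" .
  moreover have "([:0, 1:] ^ m) \<circ>\<^sub>p [:b, 1:] = [:b, 1:] ^ m" for m
    by (induction m) (simp_all add: pcompose_mult pcompose_1 pcompose_pCons)
  ultimately show ?thesis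
    by (simp add: translation_poly_def pcompose_diff pcompose_smult pcompose_pCons)
qed

text \<open>Invariance makes \<open>r\<close> take the value \<open>r(0)\<close> at the
  \<open>p\<close> distinct points \<open>0, b, ..., (p - 1) b\<close>. A nonzero polynomial of
  degree below \<open>p\<close> cannot have that many roots, so \<open>r - r(0)\<close>
  vanishes.\<close>

lemma translation_invariant_const:
  fixes b :: "'a :: {field, finite}"
  assumes b: "b \<noteq> 0" and r: "r \<circ>\<^sub>p [:b, 1:] = r" and deg: "degree r < CHAR('a)"
  shows "r = [:coeff r 0:]"
proof (rule ccontr)
  assume "r \<noteq> [:coeff r 0:]"
  define s where "s = r - [:coeff r 0:]"
  have "s \<noteq> 0"
    using \<open>r \<noteq> [:coeff r 0:]\<close> by (simp add: s_def)
  have "degree s < CHAR('a)"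
    using deg by (auto simp: s_def intro: le_less_trans[OF degree_diff_le_max])
  have step: "poly r (b + x) = poly r x" for x
  proof -
    have "poly (r \<circ>\<^sub>p [:b, 1:]) x = poly r (b + x)"
      by (simp add: poly_pcompose)
    thus ?thesis
      by (simp add: r)
  qed
  have "poly r (of_nat i * b) = coeff r 0" for i
    by (induction i) (simp_all add: poly_0_coeff_0 distrib_right step)
  hence sub: "(\<lambda>i. of_nat i * b) ` {..<CHAR('a)} \<subseteq> {x. poly s x = 0}"
    by (auto simp: s_def)
  have "inj_on (\<lambda>i. of_nat i * b) {..<CHAR('a)}"
  proof (rule inj_onI)
    have *: "i \<ge> j" if "i < CHAR('a)" "j < CHAR('a)" "(of_nat i :: 'a) = of_nat j" for i j
    proof (rule ccontr)
      assume "\<not> i \<ge> j"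
      hence "CHAR('a) dvd j - i"
        using that(3) by (simp add: of_nat_diff flip: of_nat_eq_0_iff_char_dvd)
      thus False
        using \<open>\<not> i \<ge> j\<close> that by (auto dest: dvd_imp_le)
    qed
    fix i j assume "i \<in> {..<CHAR('a)}" "j \<in> {..<CHAR('a)}" "of_nat i * b = of_nat j * b"
    thus "i = j"
      using *[of i j] *[of j i] b by auto
  qed
  hence "CHAR('a) = card ((\<lambda>i. of_nat i * b) ` {..<CHAR('a)})"
    by (simp add: card_image)
  also have "\<dots> \<le> card {x. poly s x = 0}"
    by (intro card_mono sub) simp
  also have "\<dots> \<le> degree s"
    by (rule card_poly_roots_bound) fact
  finally show False
    using \<open>degree s < CHAR('a)\<close> by simp
qed

text \<open>Divide by the invariant polynomial \<open>P\<close>: uniqueness of division makes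
  quotient and remainder invariant. The remainder has degree below \<open>p\<close>, so it is
  constant, and the quotient is handled by induction on the degree.\<close>

lemma translation_invariant_decomp:
  fixes b :: "'a :: {field, finite}"
  assumes b: "b \<noteq> 0"
  shows "h \<circ>\<^sub>p [:b, 1:] = h \<Longrightarrow> \<exists>g. h = g \<circ>\<^sub>p translation_poly b"
proof (induction "degree h" arbitrary: h rule: less_induct)
  case less
  let ?P = "translation_poly b"
  define k r where "k = h div ?P" and "r = h mod ?P"
  have h: "h = k * ?P + r"
    by (simp add: k_def r_def)
  have P: "degree ?P = CHAR('a)" "?P \<noteq> 0" "CHAR('a) > 0"
    using monic_translation_poly[of b] prime_gt_0_nat[OF prime_CHAR_finite_field] by fastforce+
  have deg_r: "degree r < CHAR('a)"
    using degree_mod_less'[of ?P h] P by (cases "r = 0") (auto simp: r_def)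
  have "k \<circ>\<^sub>p [:b, 1:] * ?P + r \<circ>\<^sub>p [:b, 1:] = k * ?P + r"
    using less.prems translation_poly_invariant[of b]
    unfolding h by (simp add: pcompose_add pcompose_mult)
  hence eq: "(k \<circ>\<^sub>p [:b, 1:] - k) * ?P = r - r \<circ>\<^sub>p [:b, 1:]"
    by (simp add: algebra_simps)
  \<comment> \<open>A multiple of \<open>P\<close> whose degree is below that of \<open>P\<close> is
    0, so both sides of \<open>eq\<close> vanish.\<close>
  have "degree (r - r \<circ>\<^sub>p [:b, 1:]) < degree ?P"
    using deg_r P by (intro le_less_trans[OF degree_diff_le_max]) (simp add: degree_pcompose)
  hence k: "k \<circ>\<^sub>p [:b, 1:] = k"
    unfolding eq[symmetric] using P(2) degree_mult_eq[of "k \<circ>\<^sub>p [:b, 1:] - k" ?P] by fastforce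
  hence "r \<circ>\<^sub>p [:b, 1:] = r"
    using eq by simp
  hence r: "r = [:coeff r 0:]"
    using translation_invariant_const b deg_r by blast
  \<comment> \<open>The case \<open>k = 0\<close> is separate because the degree need not drop when
    \<open>h\<close> is constant.\<close>
  have "\<exists>g. k = g \<circ>\<^sub>p ?P"
  proof (cases "k = 0")
    case True
    thus ?thesis
      by (intro exI[of _ 0]) simp
  next
    case False
    have "degree h = degree (k * ?P)"
      unfolding h using deg_r P False
      by (intro degree_add_eq_left) (simp add: degree_mult_eq)
    hence "degree k < degree h"
      using P False by (simp add: degree_mult_eq)
    thus ?thesis
      using less.hyps k by blast
  qed
  then obtain g where "k = g \<circ>\<^sub>p ?P"
    by blast
  \<comment> \<open>If \<open>k\<close> is \<open>g\<close> at \<open>P\<close>, then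
    \<open>k * P + r\<close> is the polynomial \<open>X * g + r\<close> at \<open>P\<close>.\<close>
  hence "h = pCons (coeff r 0) g \<circ>\<^sub>p ?P"
    using h r by (simp add: pcompose_pCons algebra_simps)
  thus ?case
    by blast
qed

text \<open>The shift changes only the linear term, by the constant \<open>e * b\<close>. This shows
  that such polynomials are fixed, and it later recovers \<open>e\<close> from the
  polynomial.\<close>

lemma translate_decomp:
  fixes b :: "'a :: {field, finite}"
  shows "(smult e [:0, 1:] + g \<circ>\<^sub>p translation_poly b) \<circ>\<^sub>p [:b, 1:] =
    [:e * b:] + (smult e [:0, 1:] + g \<circ>\<^sub>p translation_poly b)"
proof -
  have "smult e [:0, 1:] \<circ>\<^sub>p [:b, 1:] = [:e * b:] + smult e [:0, 1:]"
    by (simp add: pcompose_pCons)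
  moreover have "g \<circ>\<^sub>p translation_poly b \<circ>\<^sub>p [:b, 1:] = g \<circ>\<^sub>p translation_poly b"
    by (metis pcompose_assoc translation_poly_invariant)
  ultimately show ?thesis
    by (simp only: pcompose_add add.assoc)
qed

text \<open>Being fixed means that the shift adds a constant \<open>c\<close>; removing a suitable
  multiple of \<open>X\<close> leaves an invariant polynomial, that is, some \<open>g\<close> at
  \<open>P\<close>. For \<open>n > 1\<close> the linear term affects neither degree nor leading
  coefficient, so \<open>n\<close> must be \<open>p\<close> times the degree of
  \<open>g\<close>.\<close>

lemma fixed_polys_translation:
  fixes b :: "'a :: {field, finite}"
  assumes b: "b \<noteq> 0" and n: "n > 1"
  shows "fixed_polys n 1 b = (if CHAR('a) dvd n
    then (\<lambda>(e, g). smult e [:0, 1:] + g \<circ>\<^sub>p translation_poly b) ` (UNIV \<times> monic0 (n div CHAR('a)))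
    else {})" (is "?F = (if _ then ?\<Phi> ` ?S else {})")
proof -
  let ?P = "translation_poly b" and ?p = "CHAR('a)"
  have P: "degree ?P = ?p" "lead_coeff ?P = 1" "coeff ?P 0 = 0"
    using monic_translation_poly by auto
  have p: "?p > 0"
    using prime_gt_0_nat[OF prime_CHAR_finite_field] .
  have deg_lin: "degree (smult e [:0, 1 :: 'a:]) < n" for e
    using n by (intro le_less_trans[OF degree_smult_le]) simp
  have monic_iff: "smult e [:0, 1:] + g \<circ>\<^sub>p ?P \<in> monic0 n \<longleftrightarrow> ?p dvd n \<and> g \<in> monic0 (n div ?p)" for e g
  proof -
    have "coeff (smult e [:0, 1 :: 'a:]) n = 0"
      using deg_lin by (rule coeff_eq_0)
    hence "coeff (smult e [:0, 1:] + g \<circ>\<^sub>p ?P) n = coeff (g \<circ>\<^sub>p ?P) n"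
      by simp
    moreover have "degree (smult e [:0, 1:] + g \<circ>\<^sub>p ?P) = n \<longleftrightarrow> degree (g \<circ>\<^sub>p ?P) = n"
    proof
      assume *: "degree (smult e [:0, 1:] + g \<circ>\<^sub>p ?P) = n"
      have "g \<circ>\<^sub>p ?P = smult (-e) [:0, 1:] + (smult e [:0, 1:] + g \<circ>\<^sub>p ?P)"
        by simp
      also have "degree \<dots> = n"
        using * deg_lin[of "-e"] by (subst degree_add_eq_right) auto
      finally show "degree (g \<circ>\<^sub>p ?P) = n" .
    qed (use deg_lin in \<open>simp add: degree_add_eq_right\<close>)
    moreover have "coeff (smult e [:0, 1:] + g \<circ>\<^sub>p ?P) 0 = coeff g 0"
      by (simp add: P poly_0_coeff_0)
    moreover have "degree (g \<circ>\<^sub>p ?P) = degree g * ?p"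
      by (simp add: degree_pcompose P)
    moreover have "lead_coeff (g \<circ>\<^sub>p ?P) = lead_coeff g"
      using P p by (subst lead_coeff_comp) auto
    moreover have "degree g * ?p = n \<longleftrightarrow> ?p dvd n \<and> degree g = n div ?p"
      using p by auto
    ultimately show ?thesis
      unfolding monic0_def by auto
  qed
  have eq: "?F = {smult e [:0, 1:] + g \<circ>\<^sub>p ?P | e g. ?p dvd n \<and> g \<in> monic0 (n div ?p)}" (is "_ = ?R")
  proof (intro equalityI subsetI)
    fix f assume "f \<in> ?F"
    then obtain c where c: "f \<circ>\<^sub>p [:b, 1:] = f + [:c:]" and f: "f \<in> monic0 n"
      by (auto simp: fixed_polys_def)
    \<comment> \<open>The shift by \<open>b\<close> adds exactly \<open>c\<close> to
      \<open>(c / b) X\<close>, so the difference is invariant.\<close>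
    define h where "h = f - smult (c / b) [:0, 1:]"
    have "h \<circ>\<^sub>p [:b, 1:] = h"
      using b c by (simp add: h_def pcompose_diff pcompose_pCons)
    then obtain g where "h = g \<circ>\<^sub>p ?P"
      using translation_invariant_decomp b by blast
    hence "f = smult (c / b) [:0, 1:] + g \<circ>\<^sub>p ?P"
      by (simp add: h_def algebra_simps)
    thus "f \<in> ?R"
      using f monic_iff by blast
  next
    fix f assume "f \<in> ?R"
    then obtain e g where f: "f = smult e [:0, 1:] + g \<circ>\<^sub>p ?P" "f \<in> monic0 n"
      using monic_iff by blast
    have "f \<circ>\<^sub>p [:b, 1:] = smult (1 ^ n) f + [:e * b:]"
      unfolding f(1) translate_decomp by (simp only: power_one smult_1_left add.commute)
    thus "f \<in> ?F"
      using f(2) unfolding fixed_polys_def by blast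
  qed
  show ?thesis
  proof (cases "?p dvd n")
    case True
    have "?F = {?\<Phi> (e, g) | e g. (e, g) \<in> ?S}"
      using True unfolding eq by simp
    also have "\<dots> = ?\<Phi> ` ?S"
      by blast
    finally show ?thesis
      using True by simp
  qed (simp add: eq)
qed

text \<open>If \<open>p\<close> divides \<open>n\<close>, the pair \<open>(e, g)\<close> is
  determined by the polynomial, which gives \<open>q\<close> choices of \<open>e\<close> times
  \<open>q ^ (n div p - 1)\<close> choices of \<open>g\<close>. For \<open>n = 1\<close> the only
  normalized polynomial is \<open>X\<close>, and every translation fixes it.\<close>

lemma card_fixed_polys_translation:
  fixes b :: "'a :: {field, finite}"
  assumes b: "b \<noteq> 0" and n: "n \<ge> 1"
  shows "card (fixed_polys n 1 b) =
    (if CHAR('a) dvd n then CARD('a) ^ (n div CHAR('a)) else if n = 1 then 1 else 0)"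
proof (cases "n = 1")
  case True
  have "[:0, 1:] \<in> (monic0 1 :: 'a poly set)"
    by (simp add: monic0_def)
  moreover have "card (monic0 1 :: 'a poly set) = 1"
    by (simp add: card_monic0)
  then obtain f :: "'a poly" where "monic0 1 = {f}"
    by (rule card_1_singletonE)
  ultimately have "monic0 1 = {[:0, 1 :: 'a:]}"
    by auto
  hence "fixed_polys 1 1 b = {[:0, 1:]}"
    by (auto simp: fixed_polys_def pcompose_pCons)
  thus ?thesis
    using True by (simp add: CHAR_not_1)
next
  case False
  let ?P = "translation_poly b" and ?p = "CHAR('a)"
  let ?\<Phi> = "\<lambda>(e, g). smult e [:0, 1:] + g \<circ>\<^sub>p ?P"
  have p: "?p > 0"
    using prime_gt_0_nat[OF prime_CHAR_finite_field] .
  have "inj ?\<Phi>"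
  proof (rule injI, clarsimp simp del: smult_pCons)
    fix e e' g g' assume *: "smult e [:0, 1:] + g \<circ>\<^sub>p ?P = smult e' [:0, 1:] + g' \<circ>\<^sub>p ?P"
    \<comment> \<open>Shifting both sides and comparing the added constants \<open>e * b\<close> and
      \<open>e' * b\<close> gives \<open>e = e'\<close>; then \<open>g = g'\<close>, as composition
      with a nonconstant polynomial is injective.\<close>
    hence "(smult e [:0, 1:] + g \<circ>\<^sub>p ?P) \<circ>\<^sub>p [:b, 1:] = (smult e' [:0, 1:] + g' \<circ>\<^sub>p ?P) \<circ>\<^sub>p [:b, 1:]"
      by simp
    hence "[:e * b:] + (smult e [:0, 1:] + g \<circ>\<^sub>p ?P) = [:e' * b:] + (smult e' [:0, 1:] + g' \<circ>\<^sub>p ?P)"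
      unfolding translate_decomp .
    with * b have "e = e'"
      by (metis add_right_cancel mult_right_cancel pCons_eq_iff)
    with * have "(g - g') \<circ>\<^sub>p ?P = 0"
      by (simp add: pcompose_diff)
    hence "g - g' = 0"
      by (rule pcompose_eq_0) (use p in \<open>simp add: monic_translation_poly\<close>)
    thus "e = e' \<and> g = g'"
      using \<open>e = e'\<close> by simp
  qed
  hence card: "card (?\<Phi> ` (UNIV \<times> monic0 m)) = CARD('a) * card (monic0 m :: 'a poly set)" for m
    by (subst card_image) (auto intro: inj_on_subset simp: card_cartesian_product)
  show ?thesis
  proof (cases "?p dvd n")
    case True
    hence pos: "n div ?p \<ge> 1"
      using n p by (auto elim!: dvdE)
    have "card (fixed_polys n 1 b) = CARD('a) * CARD('a) ^ (n div ?p - 1)"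
      using False n True pos fixed_polys_translation[OF b, of n]
      by (simp add: card card_monic0 del: smult_pCons)
    also have "\<dots> = CARD('a) ^ (n div ?p)"
      using pos by (simp flip: power_Suc)
    finally show ?thesis
      using True by simp
  qed (use False n fixed_polys_translation[OF b, of n] in simp)
qed

subsection \<open>The action on normalized polynomials\<close>

definition normalize0 :: "'a :: field poly \<Rightarrow> 'a poly" where
  "normalize0 f = smult (inverse (lead_coeff f)) (f - [:coeff f 0:])"

text \<open>The scalar cancels against the leading coefficient and \<open>c\<close> goes away with
  the constant term; degree at least 1 keeps \<open>c\<close> out of the leading
  coefficient.\<close>

lemma normalize0_affine:
  assumes "degree f \<ge> 1" "e \<noteq> 0"
  shows "normalize0 (smult e f + [:c:]) = normalize0 f"
proof -
  have "lead_coeff (smult e f + [:c:]) = e * lead_coeff f"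
    using assms lead_coeff_add_le[of "[:c:]" "smult e f"] by (simp add: add.commute)
  moreover have "smult e f + [:c:] - [:coeff (smult e f + [:c:]) 0:] = smult e (f - [:coeff f 0:])"
    by (simp add: smult_diff_right poly_eq_iff coeff_pCons split: nat.splits)
  ultimately show ?thesis
    unfolding normalize0_def using assms by (simp only: smult_smult) (simp add: field_simps)
qed

lemma normalize0_eq: "normalize0 f =
    smult (inverse (lead_coeff f)) f + [:- inverse (lead_coeff f) * coeff f 0:]"
  by (simp add: normalize0_def smult_diff_right)

lemma normalize0_in_monic0:
  assumes "degree f = n" "n \<ge> 1"
  shows "normalize0 f \<in> monic0 n"
proof -
  have "lead_coeff f \<noteq> 0"
    using assms by auto
  hence "degree (normalize0 f) = n"
    unfolding normalize0_eq using assms by (subst degree_add_eq_left) auto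
  moreover have "coeff (normalize0 f) n = 1" "coeff (normalize0 f) 0 = 0"
    using assms \<open>lead_coeff f \<noteq> 0\<close>
    by (auto simp: normalize0_def coeff_pCons split: nat.splits)
  ultimately show ?thesis
    by (simp add: monic0_def)
qed

lemma normalize0_id: "f \<in> monic0 n \<Longrightarrow> normalize0 f = f"
  by (auto simp: normalize0_def monic0_def)

lemma AGL1_cases:
  assumes "\<alpha> \<in> AGL1"
  obtains a b where "\<alpha> = [:b, a:]" "a \<noteq> 0"
  using assms by (auto simp: AGL1_def)

lemma pcompose_affine_left: "[:b, a:] \<circ>\<^sub>p f = smult a f + [:b:]"
  by (simp add: pcompose_pCons add.commute)

lemma degree_pcompose_AGL1:
  fixes f :: "'a :: field poly"
  shows "\<beta> \<in> AGL1 \<Longrightarrow> degree (f \<circ>\<^sub>p \<beta>) = degree f"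
  by (auto elim!: AGL1_cases simp: degree_pcompose)

lemma nonconst_polys_iff: "f \<in> nonconst_polys \<longleftrightarrow> degree f \<ge> 1"
proof -
  have "f \<in> range (\<lambda>c. [:c:]) \<longleftrightarrow> degree f = 0"
    by (auto elim: degree_eq_zeroE)
  thus ?thesis
    by (auto simp: nonconst_polys_def)
qed

lemma affine_equiv_normalize0:
  assumes f: "degree f \<ge> 1"
  shows "(f, normalize0 f) \<in> affine_equiv"
proof -
  let ?\<alpha> = "[:- inverse (lead_coeff f) * coeff f 0, inverse (lead_coeff f):]"
  have "lead_coeff f \<noteq> 0"
    using f by auto
  hence "?\<alpha> \<in> AGL1"
    by (simp add: AGL1_def)
  moreover have "normalize0 f = ?\<alpha> \<circ>\<^sub>p f \<circ>\<^sub>p [:0, 1:]"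
    by (simp only: pcompose_affine_left normalize0_eq pcompose_idR)
  moreover have "degree (normalize0 f) \<ge> 1"
    using normalize0_in_monic0[OF refl f] f by (simp add: monic0_def)
  ultimately show ?thesis
    unfolding affine_equiv_def using f AGL1_id by (auto simp only: nonconst_polys_iff mem_Collect_eq prod.case)
qed

text \<open>Normalization absorbs the left factor \<open>\<alpha>\<close>, and a member of
  \<open>monic0 n\<close> is its own normalization, so only \<open>\<beta>\<close> is left. This
  identifies equivalence with the orbit relation required by \<open>burnside\<close>.\<close>

lemma affine_equiv_monic0_iff:
  assumes "n \<ge> 1" "f \<in> monic0 n" "g \<in> monic0 n"
  shows "(f, g) \<in> affine_equiv \<longleftrightarrow> (\<exists>\<beta>\<in>AGL1. normalize0 (f \<circ>\<^sub>p \<beta>) = g)"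
proof
  assume "(f, g) \<in> affine_equiv"
  then obtain \<alpha> \<beta> where *: "\<alpha> \<in> AGL1" "\<beta> \<in> AGL1" "g = \<alpha> \<circ>\<^sub>p f \<circ>\<^sub>p \<beta>"
    by (auto simp: affine_equiv_def)
  from *(1) obtain a b where ab: "\<alpha> = [:b, a:]" "a \<noteq> 0"
    by (rule AGL1_cases)
  have "g = smult a (f \<circ>\<^sub>p \<beta>) + [:b:]"
    unfolding *(3) ab(1) by (metis pcompose_affine_left pcompose_assoc)
  moreover have "degree (f \<circ>\<^sub>p \<beta>) \<ge> 1"
    using assms * by (simp add: degree_pcompose_AGL1 monic0_def)
  ultimately have "normalize0 g = normalize0 (f \<circ>\<^sub>p \<beta>)"
    using ab normalize0_affine by blast
  thus "\<exists>\<beta>\<in>AGL1. normalize0 (f \<circ>\<^sub>p \<beta>) = g"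
    using *(2) normalize0_id[OF assms(3)] by auto
next
  assume "\<exists>\<beta>\<in>AGL1. normalize0 (f \<circ>\<^sub>p \<beta>) = g"
  then obtain \<beta> where \<beta>: "\<beta> \<in> AGL1" "normalize0 (f \<circ>\<^sub>p \<beta>) = g"
    by blast
  have deg: "degree f \<ge> 1" "degree (f \<circ>\<^sub>p \<beta>) \<ge> 1"
    using assms \<beta> by (simp_all add: degree_pcompose_AGL1 monic0_def)
  have "f \<circ>\<^sub>p \<beta> = [:0, 1:] \<circ>\<^sub>p f \<circ>\<^sub>p \<beta>"
    by (simp add: pcompose_pCons)
  hence "(f, f \<circ>\<^sub>p \<beta>) \<in> affine_equiv"
    unfolding affine_equiv_def using \<beta>(1) AGL1_id deg nonconst_polys_iff by blast
  moreover have "(f \<circ>\<^sub>p \<beta>, g) \<in> affine_equiv"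
    using affine_equiv_normalize0[OF deg(2)] \<beta>(2) by simp
  ultimately show "(f, g) \<in> affine_equiv"
    using equiv_affine_equiv by (meson equivE transD)
qed

text \<open>The inner normalization is a left affine map; it commutes with substitution on the right
  and is absorbed by the outer normalization. Hence substitution followed by normalization is a
  right action.\<close>

lemma normalize0_pcompose_comp:
  assumes "\<beta> \<in> AGL1" "\<gamma> \<in> AGL1" "degree f \<ge> 1"
  shows "normalize0 (normalize0 (f \<circ>\<^sub>p \<beta>) \<circ>\<^sub>p \<gamma>) = normalize0 (f \<circ>\<^sub>p (\<beta> \<circ>\<^sub>p \<gamma>))"
proof -
  let ?l = "inverse (lead_coeff (f \<circ>\<^sub>p \<beta>))"
  have deg: "degree (f \<circ>\<^sub>p \<beta>) \<ge> 1" "degree (f \<circ>\<^sub>p \<beta> \<circ>\<^sub>p \<gamma>) \<ge> 1"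
    using assms by (simp_all add: degree_pcompose_AGL1)
  have "normalize0 (f \<circ>\<^sub>p \<beta>) \<circ>\<^sub>p \<gamma> =
      smult ?l (f \<circ>\<^sub>p \<beta> \<circ>\<^sub>p \<gamma>) + [:- ?l * coeff (f \<circ>\<^sub>p \<beta>) 0:]"
    by (simp only: normalize0_eq pcompose_add pcompose_smult pcompose_const)
  moreover have "?l \<noteq> 0"
    using deg(1) by auto
  ultimately show ?thesis
    using normalize0_affine[OF deg(2)] by (simp add: pcompose_assoc)
qed

lemma bij_betw_AGL1_pcompose:
  assumes "\<beta> \<in> AGL1"
  shows "bij_betw ((\<circ>\<^sub>p) \<beta>) AGL1 AGL1"
proof -
  obtain \<beta>' where *: "\<beta>' \<in> AGL1" "\<beta>' \<circ>\<^sub>p \<beta> = [:0, 1:]" "\<beta> \<circ>\<^sub>p \<beta>' = [:0, 1:]"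
    by (rule AGL1_inverse[OF assms])
  have X: "[:0, 1:] \<circ>\<^sub>p f = f" for f :: "'a poly"
    by (simp add: pcompose_pCons)
  show ?thesis
    by (rule bij_betwI[of _ _ _ "(\<circ>\<^sub>p) \<beta>'"])
       (use assms * in \<open>auto simp: AGL1_pcompose pcompose_assoc X\<close>)
qed

text \<open>As \<open>f\<close> is monic of degree \<open>n\<close>, substituting
  \<open>a X + b\<close> gives leading coefficient \<open>a ^ n\<close>. Normalizing therefore
  divides by \<open>a ^ n\<close> and leaves only the constant open.\<close>

lemma normalize0_pcompose_fixed_iff:
  assumes f: "f \<in> monic0 n" and n: "n \<ge> 1" and a: "a \<noteq> 0"
  shows "normalize0 (f \<circ>\<^sub>p [:b, a:]) = f \<longleftrightarrow>
    (\<exists>c. f \<circ>\<^sub>p [:b, a:] = smult (a ^ n) f + [:c:])"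
proof
  let ?g = "f \<circ>\<^sub>p [:b, a:]"
  have deg: "degree f = n" "lead_coeff f = 1"
    using f by (auto simp: monic0_def)
  have lc: "lead_coeff ?g = a ^ n"
    using a deg by (subst lead_coeff_comp) auto
  assume "normalize0 ?g = f"
  hence "smult (a ^ n) f = ?g - [:coeff ?g 0:]"
  proof -
    have "smult (a ^ n) f = smult (a ^ n) (normalize0 ?g)"
      using \<open>normalize0 ?g = f\<close> by simp
    also have "\<dots> = ?g - [:coeff ?g 0:]"
      unfolding normalize0_def lc using a by simp
    finally show ?thesis .
  qed
  thus "\<exists>c. ?g = smult (a ^ n) f + [:c:]"
    by (intro exI[of _ "coeff ?g 0"]) simp
next
  assume "\<exists>c. f \<circ>\<^sub>p [:b, a:] = smult (a ^ n) f + [:c:]"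
  thus "normalize0 (f \<circ>\<^sub>p [:b, a:]) = f"
    using normalize0_affine[of f "a ^ n"] f n a normalize0_id[OF f] by (auto simp: monic0_def)
qed

section \<open>The orbit count over AGL(1, q) and the final formula\<close>

lemma sum_AGL1:
  "(\<Sum>\<beta>\<in>AGL1. h \<beta>) = (\<Sum>a\<in>UNIV - {0 :: 'a :: {field, finite}}. \<Sum>b\<in>UNIV. h [:b, a:])"
proof -
  have AGL1: "AGL1 = (\<lambda>(a, b). [:b, a :: 'a:]) ` ((UNIV - {0}) \<times> UNIV)"
    by (auto simp: AGL1_def image_iff)
  have "inj_on (\<lambda>(a, b). [:b, a :: 'a:]) ((UNIV - {0}) \<times> UNIV)"
    by (auto simp: inj_on_def)
  hence "(\<Sum>\<beta>\<in>AGL1. h \<beta>) = (\<Sum>(a, b)\<in>(UNIV - {0 :: 'a}) \<times> UNIV. h [:b, a:])"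
    unfolding AGL1 by (subst sum.reindex) (simp_all add: case_prod_unfold)
  thus ?thesis
    by (simp add: sum.cartesian_product)
qed

lemma num_classes_burnside:
  assumes n: "n \<ge> 1"
  shows "num_classes TYPE('a :: {field, finite}) n * (CARD('a) * (CARD('a) - 1)) =
    (\<Sum>a\<in>UNIV - {0 :: 'a}. \<Sum>b\<in>UNIV. card (fixed_polys n a b))"
proof -
  let ?R = "affine_equiv :: ('a poly \<times> 'a poly) set"
  let ?M = "monic0 n :: 'a poly set"
  have M: "degree f = n" if "f \<in> ?M" for f
    using that by (simp add: monic0_def)
  \<comment> \<open>Every class of degree \<open>n\<close> contains a normalized polynomial, so both
    sets yield the same classes.\<close>
  have quot: "{f. degree f = n} // ?R = ?M // ?R"
  proof -
    have "?R `` {f} \<in> ?M // ?R" if "degree f = n" for f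
    proof -
      have "?R `` {f} = ?R `` {normalize0 f}"
        using affine_equiv_normalize0[of f] n that equiv_affine_equiv
        by (intro equiv_class_eq) auto
      thus ?thesis
        using normalize0_in_monic0[OF that n] by (simp add: quotientI)
    qed
    thus ?thesis
      using M by (auto simp: quotient_def)
  qed
  have card_AGL1: "card (AGL1 :: 'a poly set) = CARD('a) * (CARD('a) - 1)"
    using sum_AGL1[of "\<lambda>_ :: 'a poly. 1 :: nat"] by (simp add: card_Diff_singleton)
  have "finite (AGL1 :: 'a poly set)"
    using card_field_ge_2[where 'a = 'a] by (intro card_ge_0_finite) (simp add: card_AGL1)
  hence "card (?M // ?R) * card (AGL1 :: 'a poly set) =
      (\<Sum>\<beta>\<in>AGL1. card {f \<in> ?M. normalize0 (f \<circ>\<^sub>p \<beta>) = f})"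
  proof (rule burnside[where comp = "(\<circ>\<^sub>p)" and A = nonconst_polys])
    show "?M \<subseteq> nonconst_polys"
      using M n by (auto simp: nonconst_polys_iff)
  qed (use n M in \<open>auto simp: finite_monic0 equiv_affine_equiv affine_equiv_monic0_iff
         normalize0_pcompose_comp bij_betw_AGL1_pcompose degree_pcompose_AGL1
         intro!: normalize0_in_monic0\<close>)
  also have "\<dots> = (\<Sum>a\<in>UNIV - {0 :: 'a}. \<Sum>b\<in>UNIV. card {f \<in> ?M. normalize0 (f \<circ>\<^sub>p [:b, a:]) = f})"
    by (rule sum_AGL1)
  also have "\<dots> = (\<Sum>a\<in>UNIV - {0 :: 'a}. \<Sum>b\<in>UNIV. card (fixed_polys n a b))"
    using n unfolding fixed_polys_def
    by (intro sum.cong refl arg_cong[where f = card] Collect_cong conj_cong)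
       (auto simp: normalize0_pcompose_fixed_iff)
  finally show ?thesis
    unfolding num_classes_def quot card_AGL1 .
qed

text \<open>With \<open>k = (n - 1) div d\<close>, division with remainder gives
  \<open>d * k < n \<le> d * (k + 1)\<close>, so the ceiling is \<open>k + 1\<close>. This matches
  the exponent in the theorem with the number of free coefficients.\<close>

lemma ceiling_divide_nat:
  assumes "n \<ge> 1" "d \<ge> 1"
  shows "\<lceil>real n / real d\<rceil> - 1 = int ((n - 1) div d)"
proof -
  define k r where "k = (n - 1) div d" and "r = (n - 1) mod d"
  have "n - 1 = d * k + r" "r < d"
    using assms by (simp_all add: k_def r_def)
  hence "d * k < n" "n \<le> d * (k + 1)"
    using assms(1) by (simp_all add: algebra_simps)
  hence "d * ((n - 1) div d) < n" "n \<le> d * ((n - 1) div d + 1)"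
    by (simp_all only: k_def)
  hence "real (d * ((n - 1) div d)) < real n" "real n \<le> real (d * ((n - 1) div d + 1))"
    by (simp_all only: of_nat_less_iff of_nat_le_iff)
  hence "\<lceil>real n / real d\<rceil> = int ((n - 1) div d) + 1"
    using assms by (intro ceiling_unique) (auto simp: field_simps)
  thus ?thesis
    by simp
qed

theorem theorem8p2:
  fixes q p n :: nat
  assumes q: "q = CARD('a :: {field, finite})"
    and p: "p = CHAR('a)"
    and n: "n \<ge> 1"
  shows "real (num_classes TYPE('a) n) =
    real q powi (int n - 2) / (real q - 1)
    + 1 / (real q - 1) *
        (\<Sum>d | 1 < d \<and> d dvd q - 1. real (totient d) * real q powi (\<lceil>real n / real d\<rceil> - 1))
    + (if p dvd n then real q powi (int (n div p) - 1)
       else if n = 1 then real q powi (-1)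
       else 0)"
proof -
  define F where "F = (\<lambda>a b :: 'a. real (card (fixed_polys n a b)))"
  \<comment> \<open>\<open>T\<close> counts the normalized polynomials fixed by any one nontrivial
    translation; \<open>D\<close> sums the fixed points of the scalings \<open>a X\<close>,
    \<open>a \<noteq> 1\<close>, grouped by the order of \<open>a\<close>.\<close>
  define T :: nat where "T = (if p dvd n then q ^ (n div p) else if n = 1 then 1 else 0)"
  define D where "D = (\<Sum>d | 1 < d \<and> d dvd q - 1. real (totient d) * real q ^ ((n - 1) div d))"
  have q2: "q \<ge> 2"
    using card_field_ge_2[where 'a = 'a] by (simp add: q)
  have "real (num_classes TYPE('a) n) * (real q * (real q - 1)) =
      real (num_classes TYPE('a) n * (CARD('a) * (CARD('a) - 1)))"
    using q2 by (simp add: q of_nat_diff)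
  also have "\<dots> = (\<Sum>a\<in>UNIV - {0}. \<Sum>b\<in>UNIV. F a b)"
    unfolding num_classes_burnside[OF n] by (simp add: F_def)
  also have "\<dots> = (\<Sum>b\<in>UNIV. F 1 b) + (\<Sum>a\<in>UNIV - {0, 1}. \<Sum>b\<in>UNIV. F a b)"
  proof -
    have eq: "UNIV - {0, 1} = (UNIV - {0}) - {1 :: 'a}"
      by auto
    show ?thesis
      unfolding eq by (rule sum.remove) auto
  qed
  also have "(\<Sum>b\<in>UNIV. F 1 b) = F 1 0 + (\<Sum>b\<in>UNIV - {0}. F 1 b)"
    by (rule sum.remove) auto
  also have "F 1 0 = real q ^ (n - 1)"
    using n by (simp add: F_def fixed_polys_id card_monic0 q)
  also have "(\<Sum>b\<in>UNIV - {0}. F 1 b) = (\<Sum>b\<in>UNIV - {0 :: 'a}. real T)"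
    by (intro sum.cong) (auto simp: F_def T_def card_fixed_polys_translation[OF _ n] p q)
  also have "\<dots> = (real q - 1) * real T"
    using q2 by (simp add: card_Diff_singleton q of_nat_diff)
  \<comment> \<open>For fixed \<open>a \<noteq> 1\<close> all \<open>q\<close> maps
    \<open>a X + b\<close> are conjugate to \<open>a X\<close>, so they have equally many fixed
    polynomials.\<close>
  also have "(\<Sum>a\<in>UNIV - {0, 1}. \<Sum>b\<in>UNIV. F a b) = (\<Sum>a\<in>UNIV - {0, 1}. real q * F a 0)"
  proof (rule sum.cong)
    fix a :: 'a assume "a \<in> UNIV - {0, 1}"
    hence "F a b = F a 0" for b
      using card_fixed_polys_conj[OF n, of a b] by (simp add: F_def)
    hence "(\<Sum>b\<in>UNIV. F a b) = (\<Sum>b\<in>(UNIV :: 'a set). F a 0)"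
      by (intro sum.cong refl)
    thus "(\<Sum>b\<in>UNIV. F a b) = real q * F a 0"
      by (simp add: q)
  qed simp
  also have "\<dots> = real q * D"
  proof -
    have "F a 0 = real q ^ ((n - 1) div d)" if "a \<noteq> 0" "d > 0" "\<And>i. a ^ i = 1 \<longleftrightarrow> d dvd i" for a d
      unfolding F_def card_fixed_polys_scaling[OF n that] q by simp
    hence "(\<Sum>a\<in>UNIV - {0, 1}. F a 0) = D"
      unfolding D_def q by (rule sum_by_multiplicative_order)
    thus ?thesis
      by (simp only: sum_distrib_left[symmetric])
  qed
  finally have main: "real (num_classes TYPE('a) n) * (real q * (real q - 1)) =
    real q ^ (n - 1) + (real q - 1) * real T + real q * D" .
  \<comment> \<open>The integer exponents can be -1, for instance \<open>int n - 2\<close> at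
    \<open>n = 1\<close>, so each is turned into a natural power divided by
    \<open>q\<close>.\<close>
  have powi: "real q powi (int m - 1) = real q ^ m / real q" for m
    using q2 by (simp add: power_int_diff)
  have "int n - 2 = int (n - 1) - 1"
    using n by simp
  hence 1: "real q powi (int n - 2) = real q ^ (n - 1) / real q"
    by (simp only: powi)
  have 2: "(\<Sum>d | 1 < d \<and> d dvd q - 1. real (totient d) * real q powi (\<lceil>real n / real d\<rceil> - 1)) = D"
    unfolding D_def using n by (intro sum.cong) (auto simp: ceiling_divide_nat)
  have 3: "(if p dvd n then real q powi (int (n div p) - 1)
       else if n = 1 then real q powi (-1) else 0) = real T / real q"
    using q2 by (auto simp: T_def powi power_int_minus field_simps)
  \<comment> \<open>Division of the count by \<open>q * (q - 1)\<close>; here \<open>A\<close>,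
    \<open>B\<close> and \<open>S\<close> stand for \<open>q ^ (n - 1)\<close>, \<open>T\<close> and
    \<open>D\<close>.\<close>
  have solve: "N = A / Q / (Q - 1) + 1 / (Q - 1) * S + B / Q"
    if "N * (Q * (Q - 1)) = A + (Q - 1) * B + Q * S" "Q > 1" for N A B Q S :: real
  proof -
    have "N = (A + (Q - 1) * B + Q * S) / (Q * (Q - 1))"
      using that by (simp add: eq_divide_eq)
    also have "\<dots> = A / Q / (Q - 1) + 1 / (Q - 1) * S + B / Q"
      using that(2) by (simp add: add_divide_distrib)
    finally show ?thesis .
  qed
  show ?thesis
    unfolding 1 2 3 by (rule solve[OF main]) (use q2 in simp)
qed

end
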